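(* Let the 3-pan be the graph on vertices $e_1,e_2,e_3,e_4$ with edges $e_1e_2$, $e_2e_3$, $e_2e_4$, $e_3e_4$. Let $H$ be the $(e_2,1)$-ordering of the 3-pan. Then $R_<(H)=7$.
   Context: A $k$-ordering of a graph $H$ assigns distinct order-labels from $\{1,\ldots,|H|\}$ to $k$ of the vertices of $H$. For a vertex $v$ of $H$ and $1\le l\le |H|$, the $(v,l)$-ordering of $H$ is the 1-ordering in which $v$ receives order-label $l$ and no other vertex is labeled. An ordered 2-coloring on $n$ vertices is a red/blue coloring of the edges of the complete graph on vertex set $\{1,\ldots,n\}$. It contains a $k$-ordering $H$ (in a given color) if it has a subgraph isomorphic to $H$, all of whose edges have that color, such that for every $i$ the $i$-th smallest vertex of the copy corresponds to a vertex of $H$ that has order-label $i$ or no order-label. $R_<(H)$ is the least $n$ such that every ordered 2-coloring on $n$ vertices contains a monochromatic (red or blue) copy of $H$. *)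

theory Defs
  imports "HOL-Library.Ramsey" "HOL-Library.Extended_Nat"
begin

record 'a graph =
  verts :: "'a set"
  edges :: "'a set set"

definition simple_graph :: "'a graph \<Rightarrow> bool" where
  "simple_graph G \<longleftrightarrow> finite (verts G) \<and> edges G \<subseteq> [verts G]\<^bsup>2\<^esup>"

definition complete_graph :: "nat \<Rightarrow> nat graph" where
  "complete_graph n = \<lparr>verts = {1..n}, edges = [{1..n}]\<^bsup>2\<^esup>\<rparr>"

definition subgraph :: "'a graph \<Rightarrow> 'a graph \<Rightarrow> bool" where
  "subgraph S G \<longleftrightarrow> simple_graph S \<and> verts S \<subseteq> verts G \<and> edges S \<subseteq> edges G"

definition graph_iso :: "('a \<Rightarrow> 'b) \<Rightarrow> 'a graph \<Rightarrow> 'b graph \<Rightarrow> bool" where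
  "graph_iso f G S \<longleftrightarrow>
     bij_betw f (verts G) (verts S) \<and>
     (\<forall>u\<in>verts G. \<forall>v\<in>verts G. {u, v} \<in> edges G \<longleftrightarrow> {f u, f v} \<in> edges S)"

text \<open>An assignment of order-labels is a partial map; unlabeled vertices are sent to \<open>None\<close>.\<close>

definition k_ordering :: "nat \<Rightarrow> 'a graph \<Rightarrow> ('a \<rightharpoonup> nat) \<Rightarrow> bool" where
  "k_ordering k G lab \<longleftrightarrow>
     simple_graph G \<and> dom lab \<subseteq> verts G \<and> card (dom lab) = k \<and>
     inj_on lab (dom lab) \<and> ran lab \<subseteq> {1..card (verts G)}"

definition single_ordering :: "'a \<Rightarrow> nat \<Rightarrow> ('a \<rightharpoonup> nat)" where
  "single_ordering v l = [v \<mapsto> l]"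

lemma k_ordering_single_ordering:
  assumes "simple_graph G" "v \<in> verts G" "1 \<le> l" "l \<le> card (verts G)"
  shows "k_ordering 1 G (single_ordering v l)"
  using assms by (auto simp: k_ordering_def single_ordering_def ran_def)

datatype color = Red | Blue

text \<open>
  A coloring is a total function on sets of naturals, but only its values on the edges of
  \<open>complete_graph n\<close> are ever consulted. List positions start at \<open>0\<close>, so
  \<open>sorted_list_of_set W ! (i - 1)\<close> is the \<open>i\<close>-th smallest element of a finite set \<open>W\<close>.
\<close>

definition contains_ordering ::
  "nat \<Rightarrow> (nat set \<Rightarrow> color) \<Rightarrow> color \<Rightarrow> 'a graph \<Rightarrow> ('a \<rightharpoonup> nat) \<Rightarrow> bool" where
  "contains_ordering n c col G lab \<longleftrightarrow>
     (\<exists>S f. subgraph S (complete_graph n) \<and> graph_iso f G S \<and>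
        (\<forall>e\<in>edges S. c e = col) \<and>
        (\<forall>i\<in>{1..card (verts G)}. \<forall>v\<in>verts G.
           f v = sorted_list_of_set (verts S) ! (i - 1) \<longrightarrow> lab v = Some i \<or> lab v = None))"

text \<open>
  The value is \<open>\<infinity>\<close> if no \<open>n\<close> qualifies; a finite value is attained, hence is the least such \<open>n\<close>.
\<close>

definition ordered_ramsey :: "'a graph \<Rightarrow> ('a \<rightharpoonup> nat) \<Rightarrow> enat" where
  "ordered_ramsey G lab =
     (INF n\<in>{n. \<forall>c. contains_ordering n c Red G lab \<or> contains_ordering n c Blue G lab}. enat n)"

lemma ordered_ramsey_eq_enat_iff:
  "ordered_ramsey G lab = enat m \<longleftrightarrow>
     (\<forall>c. contains_ordering m c Red G lab \<or> contains_ordering m c Blue G lab) \<and>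
     (\<forall>n<m. \<exists>c. \<not> contains_ordering n c Red G lab \<and> \<not> contains_ordering n c Blue G lab)"
  (is "?L \<longleftrightarrow> ?R")
proof -
  define A where "A = {n. \<forall>c. contains_ordering n c Red G lab \<or> contains_ordering n c Blue G lab}"
  have R: "?R \<longleftrightarrow> m \<in> A \<and> (\<forall>n<m. n \<notin> A)"
    by (auto simp: A_def)
  have L: "?L \<longleftrightarrow> Inf (enat ` A) = enat m"
    by (simp add: ordered_ramsey_def A_def)
  show ?thesis
  proof
    assume ?L
    then have I: "Inf (enat ` A) = enat m" by (simp add: L)
    then have "A \<noteq> {}" by (auto simp: top_enat_def)
    then have "Inf (enat ` A) \<in> enat ` A"
      by (auto simp: Inf_enat_def intro: LeastI)
    with I have "m \<in> A" by auto
    moreover have "n \<notin> A" if "n < m" for n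
      using that I Inf_lower[of "enat n" "enat ` A"] by auto
    ultimately show ?R by (simp add: R)
  next
    assume ?R
    then have "m \<in> A" "\<And>n. n \<in> A \<Longrightarrow> m \<le> n" by (auto simp: R not_less[symmetric])
    then have "Inf (enat ` A) = enat m"
      by (intro antisym Inf_lower Inf_greatest) auto
    then show ?L by (simp add: L)
  qed
qed

datatype pan_vertex = e\<^sub>1 | e\<^sub>2 | e\<^sub>3 | e\<^sub>4

definition pan3 :: "pan_vertex graph" where
  "pan3 = \<lparr>verts = {e\<^sub>1, e\<^sub>2, e\<^sub>3, e\<^sub>4},
           edges = {{e\<^sub>1, e\<^sub>2}, {e\<^sub>2, e\<^sub>3}, {e\<^sub>2, e\<^sub>4}, {e\<^sub>3, e\<^sub>4}}\<rparr>"

lemma k_ordering_pan3: "k_ordering 1 pan3 (single_ordering e\<^sub>2 1)"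
  by (rule k_ordering_single_ordering)
     (auto simp: simple_graph_def pan3_def nsets_def)

end

(* In terms of forward neighbourhoods, a monochromatic copy is a vertex a with three larger
   neighbours in one color, two of which are joined in that color. So if there is no copy, every
   forward neighbourhood of size at least 3 in one color is a clique in the other color, and then
   its size is at most 3, by looking at its least element. On 7 vertices the neighbourhoods A, B
   of vertex 1 therefore both have size 3. If, say, 2 is in A, then 2 is joined to A - {2} in the
   color of B, so it must be joined to all of B in the color of A, which is the color of the
   clique B: a contradiction. *)

theory Submission
  imports Defs
begin

section \<open>Monochromatic copies in terms of forward neighbourhoods\<close>

definition forward_nbrs :: "nat \<Rightarrow> (nat set \<Rightarrow> color) \<Rightarrow> nat \<Rightarrow> color \<Rightarrow> nat set" where
  "forward_nbrs n c a col = {v. a < v \<and> v \<le> n \<and> c {a, v} = col}"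

lemma finite_forward_nbrs [simp]: "finite (forward_nbrs n c a col)"
  by (rule finite_subset[of _ "{..n}"]) (auto simp: forward_nbrs_def)

lemma sorted_list_of_set_nth_0:
  assumes "finite A" "A \<noteq> {}"
  shows "sorted_list_of_set A ! 0 = Min A"
  using assms by (simp add: sorted_list_of_set_nonempty)

text \<open>Only \<open>e\<^sub>2\<close> is labeled, so the order condition just puts it at the
  least vertex \<open>a\<close> of the copy. As \<open>e\<^sub>2\<close> is adjacent to all other
  vertices, these become forward neighbours of \<open>a\<close>: \<open>b\<close> and
  \<open>x\<close> complete the triangle, \<open>y\<close> is the pendant vertex.\<close>

lemma contains_pan3_iff:
  "contains_ordering n c col pan3 (single_ordering e\<^sub>2 1) \<longleftrightarrow>
     (\<exists>a\<ge>1. \<exists>b x y. {b, x, y} \<subseteq> forward_nbrs n c a col \<and> b \<noteq> x \<and> b \<noteq> y \<and> x \<noteq> y \<and> c {b, x} = col)"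
  (is "?L \<longleftrightarrow> ?R")
proof
  assume ?L
  then obtain S f where S: "subgraph S (complete_graph n)" and iso: "graph_iso f pan3 S"
    and col: "\<forall>e\<in>edges S. c e = col"
    and lab: "\<forall>i\<in>{1..card (verts pan3)}. \<forall>v\<in>verts pan3. f v = sorted_list_of_set (verts S) ! (i - 1)
                \<longrightarrow> single_ordering e\<^sub>2 1 v = Some i \<or> single_ordering e\<^sub>2 1 v = None"
    unfolding contains_ordering_def by blast
  have bij: "bij_betw f {e\<^sub>1, e\<^sub>2, e\<^sub>3, e\<^sub>4} (verts S)"
    using iso by (simp add: graph_iso_def pan3_def)
  then have vS: "verts S = {f e\<^sub>1, f e\<^sub>2, f e\<^sub>3, f e\<^sub>4}"
    by (auto simp: bij_betw_def)
  have dist: "distinct [f e\<^sub>1, f e\<^sub>2, f e\<^sub>3, f e\<^sub>4]"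
    using bij by (auto simp: bij_betw_def inj_on_def)
  have ed: "{f e\<^sub>2, f e\<^sub>1} \<in> edges S" "{f e\<^sub>2, f e\<^sub>3} \<in> edges S" "{f e\<^sub>2, f e\<^sub>4} \<in> edges S"
      "{f e\<^sub>3, f e\<^sub>4} \<in> edges S"
    using iso by (auto simp: graph_iso_def pan3_def insert_commute)
  have range: "verts S \<subseteq> {1..n}"
    using S by (auto simp: subgraph_def complete_graph_def)
  have fin: "finite (verts S)" and cardS: "card (verts S) = 4"
    using dist by (auto simp: vS)
  have "f e\<^sub>2 \<in> set (sorted_list_of_set (verts S))"
    using fin vS by (metis insertCI set_sorted_list_of_set)
  then obtain j where j: "j < 4" "f e\<^sub>2 = sorted_list_of_set (verts S) ! j"
    by (metis in_set_conv_nth length_sorted_list_of_set cardS)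
  \<comment> \<open>List positions start at 0 and order-labels at 1, so the order condition is
    applied at \<open>i = Suc j\<close>. The label of \<open>e\<^sub>2\<close> is 1, whence
    \<open>j = 0\<close>.\<close>
  have "Suc j = 1"
    using lab[rule_format, of "Suc j" "e\<^sub>2"] j by (simp add: pan3_def single_ordering_def)
  with j have "f e\<^sub>2 = Min (verts S)"
    using fin by (metis One_nat_def old.nat.inject sorted_list_of_set_nth_0 vS insert_not_empty)
  then have le: "f e\<^sub>2 \<le> v" if "v \<in> verts S" for v
    using fin that by simp
  have less: "f e\<^sub>2 < f e\<^sub>1" "f e\<^sub>2 < f e\<^sub>3" "f e\<^sub>2 < f e\<^sub>4"
    using le dist by (force simp: vS less_le)+
  have "1 \<le> f e\<^sub>2" "{f e\<^sub>3, f e\<^sub>4, f e\<^sub>1} \<subseteq> forward_nbrs n c (f e\<^sub>2) col"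
    using less range col[rule_format, OF ed(1)] col[rule_format, OF ed(2)] col[rule_format, OF ed(3)]
    by (auto simp: forward_nbrs_def vS)
  then show ?R
    using dist col[rule_format, OF ed(4)]
    by (intro exI[of _ "f e\<^sub>2"] conjI exI[of _ "f e\<^sub>3"] exI[of _ "f e\<^sub>4"] exI[of _ "f e\<^sub>1"]) auto
next
  assume ?R
  then obtain a b x y where a: "1 \<le> a" and nb: "{b, x, y} \<subseteq> forward_nbrs n c a col"
    and ne: "b \<noteq> x" "b \<noteq> y" "x \<noteq> y" and bx: "c {b, x} = col"
    by blast
  from nb have less: "a < b" "a < x" "a < y" and le: "b \<le> n" "x \<le> n" "y \<le> n"
    and ca: "c {a, b} = col" "c {a, x} = col" "c {a, y} = col"
    by (auto simp: forward_nbrs_def)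
  define S where "S = \<lparr>verts = {a, b, x, y}, edges = {{y, a}, {a, b}, {a, x}, {b, x}}\<rparr>"
  define f where "f = case_pan_vertex y a b x"
  have "Min {a, b, x, y} = a"
    using less by (intro Min_eqI) auto
  then have hd: "sorted_list_of_set {a, b, x, y} ! 0 = a"
    by (simp only: sorted_list_of_set_nth_0 finite.intros insert_not_empty not_False_eq_True)
  have len: "length (sorted_list_of_set {a, b, x, y}) = 4"
    using less ne by simp
  \<comment> \<open>The sorted list has no repetitions, so \<open>a\<close> occurs only at position
    0. The bound \<open>1 \<le> i\<close> excludes \<open>i = 0\<close>, where \<open>i - 1\<close>
    would also be 0.\<close>
  have i1: "i = 1" if "i \<in> {1..4}" "a = sorted_list_of_set {a, b, x, y} ! (i - 1)" for i
  proof -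
    have "i - 1 = 0"
      using that hd len nth_eq_iff_index_eq[OF distinct_sorted_list_of_set, of "i - 1" "{a, b, x, y}" 0]
      by auto
    then show ?thesis using that by auto
  qed
  have "subgraph S (complete_graph n)"
    using a less le ne by (auto simp: subgraph_def simple_graph_def complete_graph_def S_def nsets_def)
  moreover have "graph_iso f pan3 S"
  \<comment> \<open>\<open>S\<close> is the image of \<open>pan3\<close> under \<open>f\<close>, and
    \<open>f\<close> is injective on the whole type, so taking images of edges is injective too.
    This gives both directions of the edge condition.\<close>
  proof -
    have "inj f"
      using less ne by (auto simp: inj_def f_def split: pan_vertex.splits)
    moreover have "verts S = f ` verts pan3" "edges S = (`) f ` edges pan3"
      by (auto simp: S_def f_def pan3_def)
    moreover from \<open>inj f\<close> have "f ` {u, v} \<in> (`) f ` edges pan3 \<longleftrightarrow> {u, v} \<in> edges pan3" for u v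
      by (simp only: image_iff inj_image_eq_iff) blast
    ultimately show ?thesis
      unfolding graph_iso_def bij_betw_def by (metis image_empty image_insert inj_on_subset subset_UNIV)
  qed
  moreover have "\<forall>e\<in>edges S. c e = col"
    using ca bx by (auto simp: S_def insert_commute)
  moreover have "\<forall>i\<in>{1..card (verts pan3)}. \<forall>v\<in>verts pan3. f v = sorted_list_of_set (verts S) ! (i - 1)
      \<longrightarrow> single_ordering e\<^sub>2 1 v = Some i \<or> single_ordering e\<^sub>2 1 v = None"
  proof (intro ballI impI)
    fix i v
    assume iv: "i \<in> {1..card (verts pan3)}" "f v = sorted_list_of_set (verts S) ! (i - 1)"
    show "single_ordering e\<^sub>2 1 v = Some i \<or> single_ordering e\<^sub>2 1 v = None"
    proof (cases "v = e\<^sub>2")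
      case True
      then have "i = 1"
        using iv by (intro i1) (auto simp: pan3_def f_def S_def)
      then show ?thesis using True by (simp add: single_ordering_def)
    qed (simp add: single_ordering_def)
  qed
  ultimately show ?L
    unfolding contains_ordering_def by blast
qed

section \<open>The upper bound: seven vertices suffice\<close>

lemma forward_nbrs_clique:
  assumes free: "\<not> contains_ordering n c col pan3 (single_ordering e\<^sub>2 1)" and "1 \<le> a"
    and large: "3 \<le> card (forward_nbrs n c a col)"
    and uv: "u \<in> forward_nbrs n c a col" "v \<in> forward_nbrs n c a col" "u \<noteq> v"
  shows "c {u, v} \<noteq> col"
proof
  assume "c {u, v} = col"
  \<comment> \<open>A third neighbour \<open>y\<close> of \<open>a\<close> serves as the pendant
    vertex of a copy whose triangle is \<open>a\<close>, \<open>u\<close>, \<open>v\<close>.\<close>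
  have "card {u, v} < card (forward_nbrs n c a col)"
    using large uv by simp
  then obtain y where "y \<in> forward_nbrs n c a col" "y \<notin> {u, v}"
    by (metis card_mono finite.intros leD subsetI)
  with uv \<open>1 \<le> a\<close> \<open>c {u, v} = col\<close> show False
    using free unfolding contains_pan3_iff by (metis empty_subsetI insertI1 insertI2 insert_subset)
qed

text \<open>With four or more neighbours, the least one, \<open>m\<close>, is joined to at least
  three larger ones in the other color \<open>col'\<close>. Two of these are joined in
  \<open>col'\<close>, since they are neighbours of \<open>a\<close>, and cannot be, since they are
  neighbours of \<open>m\<close>.\<close>

lemma card_forward_nbrs_le_3:
  assumes free: "\<And>col. \<not> contains_ordering n c col pan3 (single_ordering e\<^sub>2 1)" and "1 \<le> a"
  shows "card (forward_nbrs n c a col) \<le> 3"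
proof (rule ccontr)
  define A where "A = forward_nbrs n c a col"
  define m where "m = Min A"
  assume "\<not> card (forward_nbrs n c a col) \<le> 3"
  then have card: "card A \<ge> 4" by (simp add: A_def)
  then have m: "m \<in> A" "\<And>v. v \<in> A \<Longrightarrow> m \<le> v"
    unfolding m_def by (auto simp: A_def intro!: Min_in)
  obtain col' where col': "\<And>k. k \<noteq> col \<longleftrightarrow> k = col'"
    by (metis color.exhaust color.distinct(1))
  have clique: "c {u, v} = col'" if "u \<in> A" "v \<in> A" "u \<noteq> v" for u v
    using forward_nbrs_clique[OF free \<open>1 \<le> a\<close>, of col u v] card that col' by (simp add: A_def)
  have sub: "A - {m} \<subseteq> forward_nbrs n c m col'"
  proof
    fix v assume v: "v \<in> A - {m}"
    then have "m < v" "c {m, v} = col'"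
      using m clique[of m v] by (auto simp: less_le)
    then show "v \<in> forward_nbrs n c m col'"
      using v by (auto simp: forward_nbrs_def A_def)
  qed
  have card3: "3 \<le> card (A - {m})"
    using card m(1) by (simp add: A_def)
  then obtain u v where uv: "u \<in> A - {m}" "v \<in> A - {m}" "u \<noteq> v"
    by (metis card_le_Suc0_iff_eq card.infinite not_less_eq_eq numeral_3_eq_3 Suc_leD)
  have "3 \<le> card (forward_nbrs n c m col')"
    using card3 card_mono[OF finite_forward_nbrs sub] by simp
  moreover have "1 \<le> m"
    using m(1) by (auto simp: A_def forward_nbrs_def)
  ultimately have "c {u, v} \<noteq> col'"
    using forward_nbrs_clique[OF free, of m col' u v] uv sub by auto
  then show False
    using clique uv by auto
qed

lemma contains_pan3_7:
  "\<exists>col. contains_ordering 7 c col pan3 (single_ordering e\<^sub>2 1)"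
proof (rule ccontr)
  assume "\<nexists>col. contains_ordering 7 c col pan3 (single_ordering e\<^sub>2 1)"
  then have free: "\<not> contains_ordering 7 c col pan3 (single_ordering e\<^sub>2 1)" for col
    by blast
  \<comment> \<open>Naming the color of this edge \<open>col\<close> replaces a symmetry argument:
    the vertex 2 lies in \<open>A\<close> by choice.\<close>
  obtain col where col: "c {1, 2} = col" by blast
  obtain col' where col': "\<And>k. k \<noteq> col \<longleftrightarrow> k = col'"
    by (metis color.exhaust color.distinct(1))
  have cc: "col \<noteq> col'" using col' by blast
  define A where "A = forward_nbrs 7 c 1 col"
  define B where "B = forward_nbrs 7 c 1 col'"
  have "v \<in> A \<union> B \<longleftrightarrow> v \<in> {2..7}" for v
    using col'[of "c {1, v}"] by (auto simp: A_def B_def forward_nbrs_def)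
  then have "A \<union> B = {2..7}" by blast
  moreover have AB: "A \<inter> B = {}"
    using cc by (auto simp: A_def B_def forward_nbrs_def)
  ultimately have "card A + card B = 6"
    using card_Un_disjoint[of A B] by (simp add: A_def B_def)
  moreover have "card A \<le> 3" "card B \<le> 3"
    using card_forward_nbrs_le_3[OF free] by (auto simp: A_def B_def)
  ultimately have card: "card A = 3" "card B = 3" by auto
  have cliqueA: "c {u, v} = col'" if "u \<in> A" "v \<in> A" "u \<noteq> v" for u v
    using forward_nbrs_clique[OF free, of 1 col u v] card that col' by (simp add: A_def)
  have cliqueB: "c {u, v} = col" if "u \<in> B" "v \<in> B" "u \<noteq> v" for u v
    using forward_nbrs_clique[OF free, of 1 col' u v] card that col' by (auto simp: B_def)
  have A2: "2 \<in> A" using col by (simp add: A_def forward_nbrs_def)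
  have "card (A - {2}) = 2" using A2 card by simp
  then obtain u v where uv: "A - {2} = {u, v}" "u \<noteq> v"
    by (meson card_2_iff)
  then have uv2: "u \<in> A" "v \<in> A" "u \<noteq> 2" "v \<noteq> 2" by auto
  have uvN: "u \<in> forward_nbrs 7 c 2 col'" "v \<in> forward_nbrs 7 c 2 col'"
    using uv2 A2 cliqueA[of 2 u] cliqueA[of 2 v] by (auto simp: forward_nbrs_def A_def)
  have sub: "B \<subseteq> forward_nbrs 7 c 2 col"
  proof
    fix w assume w: "w \<in> B"
    then have w': "2 < w" "w \<le> 7" "w \<noteq> u" "w \<noteq> v"
      using A2 uv2 AB by (auto simp: B_def forward_nbrs_def less_le)
    \<comment> \<open>Otherwise 2 has the three forward neighbours \<open>u\<close>,
      \<open>v\<close>, \<open>w\<close> in \<open>col'\<close>, while \<open>u\<close> and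
      \<open>v\<close> are joined in \<open>col'\<close> as members of \<open>A\<close>.\<close>
    have "c {2, w} \<noteq> col'"
    proof
      assume "c {2, w} = col'"
      then have "w \<in> forward_nbrs 7 c 2 col'"
        using w' by (simp add: forward_nbrs_def)
      then have "{u, v, w} \<subseteq> forward_nbrs 7 c 2 col'"
        using uvN by simp
      from card_mono[OF finite_forward_nbrs this]
      have "3 \<le> card (forward_nbrs 7 c 2 col')"
        using w' uv(2) by simp
      then show False
        using forward_nbrs_clique[OF free, of 2 col' u v] uvN uv cliqueA[OF uv2(1,2)] by simp
    qed
    then show "w \<in> forward_nbrs 7 c 2 col"
      using w' col' by (auto simp: forward_nbrs_def)
  qed
  \<comment> \<open>Two members of \<open>B\<close> are joined in \<open>col\<close> by
    \<open>cliqueB\<close>, but being among at least three forward neighbours of 2 in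
    \<open>col\<close> forbids this.\<close>
  obtain x y where xy: "x \<in> B" "y \<in> B" "x \<noteq> y"
    using card(2) by (auto simp: card_3_iff)
  have "3 \<le> card (forward_nbrs 7 c 2 col)"
    using card_mono[OF finite_forward_nbrs sub] card by simp
  then show False
    using forward_nbrs_clique[OF free, of 2 col x y] cliqueB[OF xy] xy sub by auto
qed

section \<open>The lower bound: a coloring of six vertices without a copy\<close>

lemma not_contains_pan3_6:
  assumes "n \<le> 6"
  shows "\<exists>c. \<forall>col. \<not> contains_ordering n c col pan3 (single_ordering e\<^sub>2 1)"
proof (intro exI allI)
  \<comment> \<open>On six vertices, the only forward neighbourhood of size three is the red one of
    1, namely \<open>{2, 3, 4}\<close>, and it spans no red edge; all others have at most two
    elements. A smaller \<open>n\<close> only shrinks these sets.\<close>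
  define R :: "nat set set" where
    "R = {{1, 2}, {1, 3}, {1, 4}, {2, 5}, {2, 6}, {3, 5}, {3, 6}}"
  define c where "c = (\<lambda>e. if e \<in> R then Red else Blue)"
  fix col
  show "\<not> contains_ordering n c col pan3 (single_ordering e\<^sub>2 1)"
  proof
    assume "contains_ordering n c col pan3 (single_ordering e\<^sub>2 1)"
    then obtain a b x y where h: "1 \<le> a" "{b, x, y} \<subseteq> forward_nbrs n c a col"
        "b \<noteq> x" "b \<noteq> y" "x \<noteq> y" "c {b, x} = col"
      unfolding contains_pan3_iff by blast
    have less: "a < b" "a < x" "a < y" "b \<le> 6" "x \<le> 6" "y \<le> 6"
      and ca: "c {a, b} = col" "c {a, x} = col" "c {a, y} = col"
      using h(2) assms by (auto simp: forward_nbrs_def)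
    have R_iff: "{u, v} \<in> R \<longleftrightarrow> u = 1 \<and> v \<in> {2, 3, 4} \<or> u \<in> {2, 3} \<and> v \<in> {5, 6}" if "u < v" for u v
      using that by (auto simp: R_def doubleton_eq_iff)
    have bx: "{b, x} \<notin> R" if "b \<in> {2, 3, 4}" "x \<in> {2, 3, 4}"
      using that by (auto simp: R_def doubleton_eq_iff)
    show False
    proof (cases col)
      case Red
      have nbrs: "a = 1 \<and> v \<in> {2, 3, 4} \<or> a \<noteq> 1 \<and> v \<in> {5, 6}" if "v \<in> {b, x, y}" for v
      proof -
        have "{a, v} \<in> R" "a < v"
          using that Red ca less by (auto simp: c_def split: if_splits)
        with R_iff[of a v] show ?thesis by auto
      qed
      have "{b, x} \<in> R"
        using Red h(6) by (auto simp: c_def split: if_splits)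
      \<comment> \<open>The red edge between \<open>b\<close> and \<open>x\<close> rules out
        \<open>a = 1\<close>; then three distinct vertices would have to lie in
        \<open>{5, 6}\<close>.\<close>
      with bx nbrs[of b] nbrs[of x] have "a \<noteq> 1" by blast
      with nbrs[of b] nbrs[of x] nbrs[of y] h(3-5) show False by auto
    next
      case Blue
      then have nR: "{a, v} \<notin> R" "a < v" "v \<le> 6" if "v \<in> {b, x, y}" for v
        using that ca less by (auto simp: c_def split: if_splits)
      \<comment> \<open>Three distinct vertices above \<open>a\<close> and at most 6 force
        \<open>a \<le> 3\<close>. Removing red neighbours leaves only 5 and 6 if
        \<open>a = 1\<close>, and at most 3 and 4 if \<open>a\<close> is 2 or 3, which is too
        few.\<close>
      consider "a = 1" | "a = 2 \<or> a = 3"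
        using h(1,3-5) less by linarith
      then show False
      proof cases
        case 1
        have "v = 5 \<or> v = 6" if "v \<in> {b, x, y}" for v
        proof -
          have "v \<noteq> 2" "v \<noteq> 3" "v \<noteq> 4"
            using nR(1)[OF that] 1 by (auto simp: R_def)
          with nR(2,3)[OF that] 1 show ?thesis by linarith
        qed
        from this[of b] this[of x] this[of y] h(3-5) show False by auto
      next
        case 2
        have R: "{2, 5} \<in> R" "{2, 6} \<in> R" "{3, 5} \<in> R" "{3, 6} \<in> R"
          by (simp_all add: R_def)
        have "v = 3 \<or> v = 4" if "v \<in> {b, x, y}" for v
        proof -
          have "v \<noteq> 5" "v \<noteq> 6"
            using nR(1)[OF that] 2 R by auto
          with nR(2,3)[OF that] 2 show ?thesis by linarith
        qed
        from this[of b] this[of x] this[of y] h(3-5) show False by auto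
      qed
    qed
  qed
qed

theorem theorem3p12:
  shows "ordered_ramsey pan3 (single_ordering e\<^sub>2 1) = 7"
proof -
  have "contains_ordering 7 c Red pan3 (single_ordering e\<^sub>2 1) \<or>
      contains_ordering 7 c Blue pan3 (single_ordering e\<^sub>2 1)" for c
    using contains_pan3_7[of c] by (metis color.exhaust)
  moreover have "\<exists>c. \<not> contains_ordering n c Red pan3 (single_ordering e\<^sub>2 1) \<and>
      \<not> contains_ordering n c Blue pan3 (single_ordering e\<^sub>2 1)" if "n < 7" for n
    using not_contains_pan3_6[of n] that by auto
  ultimately have "ordered_ramsey pan3 (single_ordering e\<^sub>2 1) = enat 7"
    unfolding ordered_ramsey_eq_enat_iff by blast
  then show ?thesis by (simp add: numeral_eq_enat)
qed

end
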